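(* Let $F$ be a field of characteristic zero, $UT_2$ the algebra of $2\times 2$ upper triangular matrices over $F$, and $\delta$ the inner derivation of $UT_2$ given by $\delta(a)=2^{-1}[e_{12},a]$ for all $a\in UT_2$, where $e_{12}$ is the matrix unit and $[a,b]=ab-ba$. Let $L=F\delta$ be the one-dimensional Lie algebra spanned by $\delta$ and let $UT_2^\delta$ denote $UT_2$ regarded as an $L$-algebra. Then the $L$-variety $\mathrm{var}^L(UT_2^\delta)$ does not have almost polynomial growth.
   Context: An $L$-algebra is an associative algebra $A$ over $F$ on which a Lie algebra $L$ acts by derivations; the action extends to the universal enveloping algebra $U(L)$. Fix a basis $\mathcal B\ni 1$ of $U(L)$. $F\langle X|L\rangle$ is the free associative algebra (without constant terms) on the free generators $x_j^{h}$, $h\in\mathcal B$, $j\in\mathbb N$, with $x_j=x_j^1$. Its elements are differential polynomials; $f(x_1,\dots,x_n)$ is a differential identity of $A$ if it vanishes under all substitutions $x_i\mapsto a_i\in A$ (with $x_i^h\mapsto h(a_i)$). $\mathrm{Id}^L(A)$ is the set of differential identities of $A$. $P_n^L=\mathrm{span}_F\{x_{\sigma(1)}^{h_1}\cdots x_{\sigma(n)}^{h_n}\mid \sigma\in S_n,\ h_i\in\mathcal B\}$ is the space of multilinear differential polynomials in $x_1,\dots,x_n$, and $c_n^L(A)=\dim_F P_n^L/(P_n^L\cap \mathrm{Id}^L(A))$ is the $n$th differential codimension of $A$. $\mathrm{var}^L(A)$, the $L$-variety generated by $A$, is the class of all $L$-algebras satisfying all differential identities of $A$. For $\mathcal V=\mathrm{var}^L(A)$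 put $c_n^L(\mathcal V)=c_n^L(A)$. $\mathcal V$ has polynomial growth if the sequence $c_n^L(\mathcal V)$, $n=1,2,\dots$, is polynomially bounded. $\mathcal V$ has almost polynomial growth if $c_n^L(\mathcal V)$ is not polynomially bounded but every proper $L$-subvariety of $\mathcal V$ has polynomial growth. *)

theory Defs
  imports
    "HOL-Combinatorics.Permutations"
    "HOL-Analysis.Cartesian_Space"
    "HOL-Algebra.QuotRing"
    "HOL-Algebra.Module"
    "HOL-Library.Poly_Mapping"
    "HOL-Library.Extended_Nat"
begin

section \<open>Algebras, Lie algebras and L-algebras\<close>

text \<open>
  The ground field is a type of class \<^class>\<open>field_char_0\<close>; it is turned into a record so that
  vector spaces are modules in the sense of HOL-Algebra. Vector spaces with a bilinear product are
  \<^typ>\<open>('f, 'a) module\<close> records whose field \<open>mult\<close> is the product (the bracket, for a Lie algebra).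
  Algebras need not be unital, so the field \<open>one\<close> is subject to no axiom.
\<close>

definition field_ring :: "'f::field ring" where
  "field_ring = \<lparr>carrier = UNIV, mult = (*), one = 1, zero = 0, add = (+)\<rparr>"

lemma cring_field_ring: "cring (field_ring :: 'f::field ring)"
  by (rule cringI, rule abelian_groupI, goal_cases)
    (auto simp: field_ring_def algebra_simps intro: exI[of _ "- _"] intro!: comm_monoidI)

locale bilinear_algebra = Module.module field_ring A
  for A :: "('f::field, 'a, 'm) module_scheme" (structure) +
  assumes mult_closed: "\<lbrakk>x \<in> carrier A; y \<in> carrier A\<rbrakk> \<Longrightarrow> x \<otimes> y \<in> carrier A"
    and mult_add_left: "\<lbrakk>x \<in> carrier A; y \<in> carrier A; z \<in> carrier A\<rbrakk>
      \<Longrightarrow> (x \<oplus> y) \<otimes> z = x \<otimes> z \<oplus> y \<otimes> z"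
    and mult_add_right: "\<lbrakk>x \<in> carrier A; y \<in> carrier A; z \<in> carrier A\<rbrakk>
      \<Longrightarrow> x \<otimes> (y \<oplus> z) = x \<otimes> y \<oplus> x \<otimes> z"
    and mult_smult_left: "\<lbrakk>x \<in> carrier A; y \<in> carrier A\<rbrakk> \<Longrightarrow> (c \<odot> x) \<otimes> y = c \<odot> (x \<otimes> y)"
    and mult_smult_right: "\<lbrakk>x \<in> carrier A; y \<in> carrier A\<rbrakk> \<Longrightarrow> x \<otimes> (c \<odot> y) = c \<odot> (x \<otimes> y)"

locale assoc_algebra = bilinear_algebra +
  assumes mult_assoc: "\<lbrakk>x \<in> carrier A; y \<in> carrier A; z \<in> carrier A\<rbrakk>
      \<Longrightarrow> (x \<otimes> y) \<otimes> z = x \<otimes> (y \<otimes> z)"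

locale lie_algebra = bilinear_algebra +
  assumes alternating: "x \<in> carrier A \<Longrightarrow> x \<otimes> x = \<zero>"
    and jacobi: "\<lbrakk>x \<in> carrier A; y \<in> carrier A; z \<in> carrier A\<rbrakk>
      \<Longrightarrow> x \<otimes> (y \<otimes> z) \<oplus> y \<otimes> (z \<otimes> x) \<oplus> z \<otimes> (x \<otimes> y) = \<zero>"

record ('f, 'a, 'l) l_alg = "('f, 'a) module" +
  act :: "'l \<Rightarrow> 'a \<Rightarrow> 'a"

locale L_algebra = L: lie_algebra L + A: assoc_algebra A
  for L :: "('f::field, 'l) module" and A :: "('f, 'a, 'l) l_alg" +
  assumes act_closed: "\<lbrakk>l \<in> carrier L; a \<in> carrier A\<rbrakk> \<Longrightarrow> act A l a \<in> carrier A"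
    and act_add: "\<lbrakk>l \<in> carrier L; a \<in> carrier A; b \<in> carrier A\<rbrakk>
      \<Longrightarrow> act A l (a \<oplus>\<^bsub>A\<^esub> b) = act A l a \<oplus>\<^bsub>A\<^esub> act A l b"
    and act_smult: "\<lbrakk>l \<in> carrier L; a \<in> carrier A\<rbrakk>
      \<Longrightarrow> act A l (c \<odot>\<^bsub>A\<^esub> a) = c \<odot>\<^bsub>A\<^esub> act A l a"
    and act_mult: "\<lbrakk>l \<in> carrier L; a \<in> carrier A; b \<in> carrier A\<rbrakk>
      \<Longrightarrow> act A l (a \<otimes>\<^bsub>A\<^esub> b) = act A l a \<otimes>\<^bsub>A\<^esub> b \<oplus>\<^bsub>A\<^esub> a \<otimes>\<^bsub>A\<^esub> act A l b"
    and add_act: "\<lbrakk>l \<in> carrier L; m \<in> carrier L; a \<in> carrier A\<rbrakk>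
      \<Longrightarrow> act A (l \<oplus>\<^bsub>L\<^esub> m) a = act A l a \<oplus>\<^bsub>A\<^esub> act A m a"
    and smult_act: "\<lbrakk>l \<in> carrier L; a \<in> carrier A\<rbrakk>
      \<Longrightarrow> act A (c \<odot>\<^bsub>L\<^esub> l) a = c \<odot>\<^bsub>A\<^esub> act A l a"
    and bracket_act: "\<lbrakk>l \<in> carrier L; m \<in> carrier L; a \<in> carrier A\<rbrakk>
      \<Longrightarrow> act A (l \<otimes>\<^bsub>L\<^esub> m) a = act A l (act A m a) \<ominus>\<^bsub>A\<^esub> act A m (act A l a)"


section \<open>Free associative algebras\<close>

text \<open>
  Words form the free monoid under concatenation, so the convolution product on
  \<^typ>\<open>'v list \<Rightarrow>\<^sub>0 'f\<close> makes this type the free unital associative algebra on the letters \<^typ>\<open>'v\<close>;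
  its unit is \<^term>\<open>Poly_Mapping.single [] 1\<close>.
\<close>

instantiation list :: (type) monoid_add
begin
definition zero_list :: "'a list" where "zero_list = []"
definition plus_list :: "'a list \<Rightarrow> 'a list \<Rightarrow> 'a list" where "plus_list = (@)"
instance by standard (simp_all add: zero_list_def plus_list_def)
end

type_synonym ('v, 'f) free_alg = "'v list \<Rightarrow>\<^sub>0 'f"

definition fa_scale :: "'f::field \<Rightarrow> ('v, 'f) free_alg \<Rightarrow> ('v, 'f) free_alg" where
  "fa_scale c f = Poly_Mapping.single [] c * f"

global_interpretation fa: vector_space "fa_scale :: 'f::field \<Rightarrow> ('v, 'f) free_alg \<Rightarrow> _"
proof
  show "fa_scale (a + b) x = fa_scale a x + fa_scale b x" for a b :: 'f and x :: "('v, 'f) free_alg"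
    by (simp add: fa_scale_def single_add distrib_right)
  show "fa_scale a (fa_scale b x) = fa_scale (a * b) x" for a b :: 'f and x :: "('v, 'f) free_alg"
    by (simp add: fa_scale_def mult_single plus_list_def flip: mult.assoc)
  show "fa_scale 1 x = x" for x :: "('v, 'f) free_alg"
    by (simp add: fa_scale_def flip: zero_list_def)
qed (simp add: fa_scale_def distrib_left)


section \<open>The universal enveloping algebra\<close>

definition tensor_ring :: "('f::field, 'l) module \<Rightarrow> ('l, 'f) free_alg ring" where
  "tensor_ring L = \<lparr>carrier = {t. \<forall>w\<in>Poly_Mapping.keys t. set w \<subseteq> carrier L},
     mult = (*), one = 1, zero = 0, add = (+)\<rparr>"

text \<open>
  The letters are the elements of the Lie algebra; the first two families of relations make the
  embedding of letters linear, the third one turns commutators into brackets.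
\<close>

definition env_relators :: "('f::field, 'l) module \<Rightarrow> ('l, 'f) free_alg set" where
  "env_relators L =
     {Poly_Mapping.single [l \<oplus>\<^bsub>L\<^esub> m] 1 - Poly_Mapping.single [l] 1 - Poly_Mapping.single [m] 1
        | l m. l \<in> carrier L \<and> m \<in> carrier L} \<union>
     {Poly_Mapping.single [c \<odot>\<^bsub>L\<^esub> l] 1 - Poly_Mapping.single [l] c | c l. l \<in> carrier L} \<union>
     {Poly_Mapping.single [l, m] 1 - Poly_Mapping.single [m, l] 1
        - Poly_Mapping.single [l \<otimes>\<^bsub>L\<^esub> m] 1 | l m. l \<in> carrier L \<and> m \<in> carrier L}"

lemma env_relators_subset:
  "env_relators L \<subseteq> carrier (tensor_ring L)" if "lie_algebra L" for L :: "('f::field,'l) module"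
proof -
  interpret lie_algebra L by fact
  have sc: "c \<odot>\<^bsub>L\<^esub> x \<in> carrier L" if "x \<in> carrier L" for c x
    using smult_closed[OF _ that, of c] by (simp add: field_ring_def)
  have "Poly_Mapping.keys (x - y) \<subseteq> Poly_Mapping.keys x \<union> Poly_Mapping.keys y" for x y :: "('l,'f) free_alg"
    by transfer auto
  then show ?thesis 
    unfolding env_relators_def tensor_ring_def
    by (auto dest!: subsetD[OF keys_diff] simp: keys_single sc mult_closed split: if_splits)
qed

definition env_ideal :: "('f::field, 'l) module \<Rightarrow> ('l, 'f) free_alg set" where
  "env_ideal L = Idl\<^bsub>tensor_ring L\<^esub> (env_relators L)"

text \<open>Elements of the enveloping algebra are cosets of the ideal.\<close>

type_synonym ('f, 'l) env = "('l, 'f) free_alg set"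

definition univ_env :: "('f::field, 'l) module \<Rightarrow> ('f, ('f, 'l) env) module" where
  "univ_env L = (let Q = tensor_ring L Quot env_ideal L in
     \<lparr>carrier = carrier Q, mult = mult Q, one = one Q, zero = zero Q, add = add Q,
      smult = (\<lambda>c u. (env_ideal L +>\<^bsub>tensor_ring L\<^esub> Poly_Mapping.single [] c) \<otimes>\<^bsub>Q\<^esub> u)\<rparr>)"

definition is_basis :: "('f::field, 'a, 'm) module_scheme \<Rightarrow> 'a set \<Rightarrow> bool" where
  "is_basis V B \<longleftrightarrow> B \<subseteq> carrier V \<and>
     (\<forall>v\<in>carrier V. \<exists>!c :: 'a \<Rightarrow>\<^sub>0 'f.
        Poly_Mapping.keys c \<subseteq> B \<and> v = (\<Oplus>\<^bsub>V\<^esub>b\<in>Poly_Mapping.keys c. Poly_Mapping.lookup c b \<odot>\<^bsub>V\<^esub> b))"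

text \<open>A word of letters acts by composition; an element of the enveloping algebra acts as any of its
  representatives, all of which act in the same way on an L-algebra.\<close>

definition tensor_act :: "('f::field, 'a, 'l) l_alg \<Rightarrow> ('l, 'f) free_alg \<Rightarrow> 'a \<Rightarrow> 'a" where
  "tensor_act A t a = (\<Oplus>\<^bsub>A\<^esub>w\<in>Poly_Mapping.keys t. Poly_Mapping.lookup t w \<odot>\<^bsub>A\<^esub> foldr (act A) w a)"

definition env_act :: "('f::field, 'a, 'l) l_alg \<Rightarrow> ('f, 'l) env \<Rightarrow> 'a \<Rightarrow> 'a" where
  "env_act A u a = (THE b. \<forall>t\<in>u. tensor_act A t a = b)"


section \<open>Differential polynomials and identities\<close>

text \<open>The letter \<^term>\<open>(j, h)\<close> is the generator written \<open>x\<^sub>j\<^sup>h\<close>.\<close>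

type_synonym ('f, 'l) dpoly = "(nat \<times> ('f, 'l) env, 'f) free_alg"

definition diff_polys :: "('f::field, 'l) env set \<Rightarrow> ('f, 'l) dpoly set" where
  "diff_polys B = {f. \<forall>w\<in>Poly_Mapping.keys f. w \<noteq> [] \<and> set w \<subseteq> UNIV \<times> B}"

fun word_prod :: "('f, 'a, 'm) module_scheme \<Rightarrow> 'a list \<Rightarrow> 'a" where
  "word_prod A [] = \<zero>\<^bsub>A\<^esub>"  (* never used: differential polynomials have no constant term *)
| "word_prod A [x] = x"
| "word_prod A (x # y # xs) = x \<otimes>\<^bsub>A\<^esub> word_prod A (y # xs)"

definition dp_eval :: "('f::field, 'a, 'l) l_alg \<Rightarrow> (nat \<Rightarrow> 'a) \<Rightarrow> ('f, 'l) dpoly \<Rightarrow> 'a" where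
  "dp_eval A a f = (\<Oplus>\<^bsub>A\<^esub>w\<in>Poly_Mapping.keys f.
     Poly_Mapping.lookup f w \<odot>\<^bsub>A\<^esub> word_prod A (map (\<lambda>(j, h). env_act A h (a j)) w))"

definition Id_L :: "('f::field, 'l) env set \<Rightarrow> ('f, 'a, 'l) l_alg \<Rightarrow> ('f, 'l) dpoly set" where
  "Id_L B A = {f \<in> diff_polys B. \<forall>a. (\<forall>j. a j \<in> carrier A) \<longrightarrow> dp_eval A a f = \<zero>\<^bsub>A\<^esub>}"


section \<open>Codimensions\<close>

definition multilinear_polys :: "('f::field, 'l) env set \<Rightarrow> nat \<Rightarrow> ('f, 'l) dpoly set" where
  "multilinear_polys B n = fa.span
     {Poly_Mapping.single (map (\<lambda>i. (\<sigma> i, h i)) [1..<Suc n]) 1 | \<sigma> h.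
        \<sigma> permutes {1..n} \<and> (\<forall>i\<in>{1..n}. h i \<in> B)}"

text \<open>Dimension of the quotient \<open>P / W\<close>, possibly infinite: the supremum of the sizes of the finite
  subsets of \<open>P\<close> that are linearly independent modulo \<open>W\<close>.\<close>

definition quotient_dim :: "('v, 'f::field) free_alg set \<Rightarrow> ('v, 'f) free_alg set \<Rightarrow> enat" where
  "quotient_dim P W = (SUP S\<in>{S. finite S \<and> S \<subseteq> P \<and>
     (\<forall>u. (\<Sum>s\<in>S. fa_scale (u s) s) \<in> W \<longrightarrow> (\<forall>s\<in>S. u s = 0))}. enat (card S))"

definition codim_of :: "('f::field, 'l) env set \<Rightarrow> ('f, 'l) dpoly set \<Rightarrow> nat \<Rightarrow> enat" where
  "codim_of B J n = quotient_dim (multilinear_polys B n) (multilinear_polys B n \<inter> J)"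

definition codim :: "('f::field, 'l) env set \<Rightarrow> ('f, 'a, 'l) l_alg \<Rightarrow> nat \<Rightarrow> enat" where
  "codim B A = codim_of B (Id_L B A)"

definition polynomially_bounded :: "(nat \<Rightarrow> enat) \<Rightarrow> bool" where
  "polynomially_bounded c \<longleftrightarrow> (\<exists>C k :: nat. \<forall>n\<ge>1. c n \<le> enat (C * n ^ k))"


section \<open>Varieties\<close>

text \<open>
  A class of algebras can only contain algebras whose carriers are subsets of one fixed type. We
  take sets of differential polynomials as elements: the relatively free algebra of countable rank
  of any variety consists of such sets (cosets of the ideal of identities). It generates the variety,
  so every variety has a generator over this type, and distinct varieties (over any types)
  give distinct classes.
\<close>

type_synonym ('f, 'l) univ_alg = "('f, ('f, 'l) dpoly set, 'l) l_alg"

definition L_var :: "('f::field, 'l) module \<Rightarrow> ('f, 'l) env set \<Rightarrow> ('f, 'a, 'l) l_alg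
    \<Rightarrow> ('f, 'l) univ_alg set" where
  "L_var L B A = {C. L_algebra L C \<and> Id_L B A \<subseteq> Id_L B C}"

definition is_L_variety :: "('f::field, 'l) module \<Rightarrow> ('f, 'l) env set \<Rightarrow> ('f, 'l) univ_alg set
    \<Rightarrow> bool" where
  "is_L_variety L B \<V> \<longleftrightarrow> (\<exists>C :: ('f, 'l) univ_alg. L_algebra L C \<and> \<V> = L_var L B C)"

definition Id_class :: "('f::field, 'l) env set \<Rightarrow> ('f, 'l) univ_alg set \<Rightarrow> ('f, 'l) dpoly set" where
  "Id_class B \<V> = {f \<in> diff_polys B. \<forall>C\<in>\<V>. f \<in> Id_L B C}"

definition codim_class :: "('f::field, 'l) env set \<Rightarrow> ('f, 'l) univ_alg set \<Rightarrow> nat \<Rightarrow> enat" where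
  "codim_class B \<V> = codim_of B (Id_class B \<V>)"

definition polynomial_growth :: "('f::field, 'l) env set \<Rightarrow> ('f, 'l) univ_alg set \<Rightarrow> bool" where
  "polynomial_growth B \<V> \<longleftrightarrow> polynomially_bounded (codim_class B \<V>)"

definition almost_polynomial_growth ::
    "('f::field, 'l) module \<Rightarrow> ('f, 'l) env set \<Rightarrow> ('f, 'l) univ_alg set \<Rightarrow> bool" where
  "almost_polynomial_growth L B \<V> \<longleftrightarrow>
     \<not> polynomial_growth B \<V> \<and>
     (\<forall>\<W>. is_L_variety L B \<W> \<longrightarrow> \<W> \<subset> \<V> \<longrightarrow> polynomial_growth B \<W>)"

lemma Id_class_L_var:
  fixes A :: "('f::field, 'l) univ_alg"
  assumes "L_algebra L A"
  shows "Id_class B (L_var L B A) = Id_L B A"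
  using assms by (auto simp: Id_class_def L_var_def Id_L_def)

lemma codim_class_L_var:
  fixes A :: "('f::field, 'l) univ_alg"
  assumes "L_algebra L A"
  shows "codim_class B (L_var L B A) = codim B A"
  using Id_class_L_var[OF assms] by (simp add: codim_class_def codim_def)


section \<open>Upper triangular matrices with the derivation \<open>\<delta>\<close>\<close>

definition e12 :: "'f::field ^ 2 ^ 2" where
  "e12 = (\<chi> i j. if i = 1 \<and> j = 2 then 1 else 0)"

definition mat_scale :: "'f::field \<Rightarrow> 'f ^ 2 ^ 2 \<Rightarrow> 'f ^ 2 ^ 2" where
  "mat_scale c a = (\<chi> i j. c * a $ i $ j)"

definition delta :: "'f::field ^ 2 ^ 2 \<Rightarrow> 'f ^ 2 ^ 2" where
  "delta a = mat_scale (inverse 2) (e12 ** a - a ** e12)"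

text \<open>
  The Lie algebra spanned by \<open>\<delta>\<close>, with the commutator of operators as its bracket. The operators are
  written on all matrices; restricting them to upper triangular ones is injective.
\<close>

definition F_delta :: "('f::field, 'f ^ 2 ^ 2 \<Rightarrow> 'f ^ 2 ^ 2) module" where
  "F_delta = \<lparr>carrier = {\<lambda>a. mat_scale c (delta a) | c. True},
     mult = (\<lambda>d d' a. d (d' a) - d' (d a)), one = (\<lambda>a. 0), zero = (\<lambda>a. 0),
     add = (\<lambda>d d' a. d a + d' a), smult = (\<lambda>c d a. mat_scale c (d a))\<rparr>"

definition UT2_delta :: "('f::field, 'f ^ 2 ^ 2, 'f ^ 2 ^ 2 \<Rightarrow> 'f ^ 2 ^ 2) l_alg" where
  "UT2_delta = \<lparr>carrier = {a. a $ 2 $ 1 = 0}, mult = (**), one = mat 1, zero = 0, add = (+),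
     smult = mat_scale, act = (\<lambda>d a. d a)\<rparr>"

lemma delta_nth: "delta a $ i $ j =
   (if i = 1 \<and> j = 1 then a $ 2 $ 1 / 2 else if i = 1 then (a $ 2 $ 2 - a $ 1 $ 1) / 2
    else if j = 2 then - a $ 2 $ 1 / 2 else (0 :: 'f::field_char_0))"
  using exhaust_2[of i] exhaust_2[of j]
  by (auto simp: delta_def mat_scale_def e12_def matrix_matrix_mult_def sum_2 field_simps)

lemma lie_algebra_F_delta: "lie_algebra (F_delta :: ('f::field_char_0, _) module)"
proof -
  let ?L = "F_delta :: ('f, 'f ^ 2 ^ 2 \<Rightarrow> 'f ^ 2 ^ 2) module"
  have ag: "abelian_group ?L"
  proof (rule abelian_groupI, goal_cases)
    case (1 x y)
    then obtain c d where "x = (\<lambda>a. mat_scale c (delta a))" "y = (\<lambda>a. mat_scale d (delta a))"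
      by (auto simp: F_delta_def)
    then show ?case 
      by (auto simp: F_delta_def mat_scale_def vec_eq_iff algebra_simps fun_eq_iff intro!: exI[of _ "c + d"])
  next
    case 2 show ?case by (auto simp: F_delta_def mat_scale_def vec_eq_iff fun_eq_iff intro!: exI[of _ 0])
  next
    case (6 x)
    then obtain c where "x = (\<lambda>a. mat_scale c (delta a))" 
      by (auto simp: F_delta_def)
    then show ?case 
      by (intro bexI[of _ "\<lambda>a. mat_scale (-c) (delta a)"])
       (auto simp: F_delta_def mat_scale_def vec_eq_iff algebra_simps fun_eq_iff intro!: exI[of _ "- c"])
  qed (auto simp: F_delta_def algebra_simps)
  have m: "Module.module field_ring ?L"
  proof (rule Module.moduleI[OF cring_field_ring ag], goal_cases)
    case (1 a x)
    then obtain c where "x = (\<lambda>a. mat_scale c (delta a))"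
      by (auto simp: F_delta_def)
    then show ?case by (auto simp: F_delta_def mat_scale_def vec_eq_iff algebra_simps fun_eq_iff intro!: exI[of _ "a * c"])
  qed (auto simp: F_delta_def field_ring_def mat_scale_def vec_eq_iff algebra_simps fun_eq_iff)
  have *: "x \<otimes>\<^bsub>?L\<^esub> y = \<zero>\<^bsub>?L\<^esub>" if "x \<in> carrier ?L" "y \<in> carrier ?L" for x y
  proof -
    from that obtain c d where "x = (\<lambda>a. mat_scale c (delta a))" "y = (\<lambda>a. mat_scale d (delta a))"
      by (auto simp: F_delta_def)
    then show ?thesis
      by (auto simp: F_delta_def vec_eq_iff fun_eq_iff delta_nth mat_scale_def)
  qed
  interpret M: Module.module field_ring ?L by fact
  have sc: "c \<odot>\<^bsub>?L\<^esub> x \<in> carrier ?L" if "x \<in> carrier ?L" for c x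
    using M.smult_closed[OF _ that, of c] by (simp add: field_ring_def)
  have s0: "c \<odot>\<^bsub>?L\<^esub> \<zero>\<^bsub>?L\<^esub> = \<zero>\<^bsub>?L\<^esub>" for c
    using M.smult_r_null[of c] by (simp add: field_ring_def)
  show ?thesis
    by unfold_locales (simp_all add: * sc s0)
qed

lemma L_algebra_UT2_delta: "L_algebra F_delta (UT2_delta :: ('f::field_char_0, _, _) l_alg)"
proof -
  let ?A = "UT2_delta :: ('f, 'f ^ 2 ^ 2, 'f ^ 2 ^ 2 \<Rightarrow> 'f ^ 2 ^ 2) l_alg"
  have ag: "abelian_group ?A"
  proof (rule abelian_groupI, goal_cases)
    case (6 x) then show ?case by (intro bexI[of _ "- x"]) (auto simp: UT2_delta_def)
  qed (auto simp: UT2_delta_def algebra_simps)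
  interpret M: Module.module field_ring ?A
    by (rule Module.moduleI[OF cring_field_ring ag])
      (auto simp: UT2_delta_def field_ring_def mat_scale_def vec_eq_iff algebra_simps)
  interpret A: assoc_algebra ?A
    by unfold_locales
     (auto simp: UT2_delta_def mat_scale_def vec_eq_iff algebra_simps matrix_matrix_mult_def sum_2)
  interpret L: lie_algebra "F_delta :: ('f, 'f ^ 2 ^ 2 \<Rightarrow> 'f ^ 2 ^ 2) module" by (rule lie_algebra_F_delta)
  have inv: "\<ominus>\<^bsub>?A\<^esub> x = - x" if "x \<in> carrier ?A" for x
    by (rule abelian_group.minus_equality[OF ag]) (use that in \<open>auto simp: UT2_delta_def\<close>)
  show ?thesis
  proof (unfold_locales, goal_cases)
    case (7 l m a)
    then have "act ?A m (act ?A l a) \<in> carrier ?A"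
      by (auto simp: UT2_delta_def F_delta_def mat_scale_def delta_nth)
    then show ?case using inv by (simp add: a_minus_def) (simp add: UT2_delta_def F_delta_def)
  qed (auto simp: UT2_delta_def F_delta_def mat_scale_def vec_eq_iff delta_nth field_simps 
       matrix_matrix_mult_def sum_2 forall_2)
qed

end

theory Submission
  imports Defs "HOL-Real_Asymp.Real_Asymp"
begin

text \<open>
  Write \<open>V\<close> for the variety of \<open>UT\<^sub>2\<close> with the derivation \<open>\<delta>\<close>. It is not of almost polynomial growth,
  because it has a proper subvariety \<open>W\<close> of exponential growth: the one generated by \<open>UT\<^sub>2\<close> with the
  zero action.

  On \<open>UT\<^sub>2\<close> the square of \<open>\<delta>\<close> vanishes, so an element \<open>h\<close> of the enveloping algebra acts through its
  constant and linear coefficients only, as \<open>c + d \<delta>\<close> (\<open>env_act_scaled_UT2\<close>). If the derivation is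
  replaced by \<open>t \<delta>\<close>, the value of a word at triangular matrices changes in a transparent way: the
  diagonal entries do not depend on \<open>t\<close>, and the corner entry is its value for \<open>t = 0\<close> plus the corner
  entry that one gets after replacing each argument by its diagonal part, since \<open>\<delta> a\<close> depends on the
  diagonal of \<open>a\<close> only (\<open>word_value_diagonal\<close>, \<open>word_value_corner\<close>). Hence an identity for
  \<open>t = 1\<close>, applied both to the given arguments and to their diagonal parts, is an identity for
  \<open>t = 0\<close>, which gives \<open>W \<subseteq> V\<close> (\<open>Id_L_UT2_delta_subset\<close>).

  The inclusion is proper: some basis element \<open>h\<close> has \<open>d \<noteq> 0\<close>, because \<open>\<delta>\<close> itself is a combination of
  basis elements (\<open>basis_env_lin\<close>), and \<open>x\<^sup>h - c x\<close> is an identity for \<open>t = 0\<close> but not for \<open>t = 1\<close>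
  (\<open>Id_L_separates_scaled_UT2\<close>).

  For the growth of \<open>W\<close>, let \<open>K\<close> range over the subsets of \<open>{2..n}\<close> and take the monomial in which the
  variables with index in \<open>K\<close> precede \<open>x\<^sub>1\<close> and the other ones follow it. Substituting \<open>e\<^sub>1\<^sub>2\<close> for
  \<open>x\<^sub>1\<close>, \<open>e\<^sub>1\<^sub>1\<close> for the variables in \<open>J\<close> and \<open>e\<^sub>2\<^sub>2\<close> for the others gives a nonzero value exactly when
  \<open>J = K\<close>. So these \<open>2\<^bsup>n-1\<^esup>\<close> monomials are independent modulo the identities
  (\<open>codim_scaled_UT2_ge\<close>).
\<close>
section \<open>Linear functionals on free algebras\<close>

text \<open>
  Values of elements of a free algebra are handled one coordinate at a time, as linear extensions of
  scalar functions on words.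
\<close>
definition lin_ext :: "('w \<Rightarrow> 'f) \<Rightarrow> ('w \<Rightarrow>\<^sub>0 'f) \<Rightarrow> 'f::field" where
  "lin_ext g p = (\<Sum>w\<in>Poly_Mapping.keys p. Poly_Mapping.lookup p w * g w)"

lemma lin_ext_superset:
  assumes "finite K" "Poly_Mapping.keys p \<subseteq> K"
  shows "lin_ext g p = (\<Sum>w\<in>K. Poly_Mapping.lookup p w * g w)"
  unfolding lin_ext_def using assms
  by (intro sum.mono_neutral_left) (auto simp: in_keys_iff)

lemma lin_ext_zero [simp]: "lin_ext g 0 = 0"
  by (simp add: lin_ext_def)

lemma lin_ext_single [simp]: "lin_ext g (Poly_Mapping.single w c) = c * g w"
  by (simp add: lin_ext_def)

lemma lin_ext_add [simp]: "lin_ext g (p + q) = lin_ext g p + lin_ext g q"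
proof -
  let ?K = "Poly_Mapping.keys p \<union> Poly_Mapping.keys q"
  have "lin_ext g r = (\<Sum>w\<in>?K. Poly_Mapping.lookup r w * g w)" if "r \<in> {p, q, p + q}" for r
    using that Poly_Mapping.keys_add[of p q] by (intro lin_ext_superset) auto
  then show ?thesis
    by (simp add: lookup_add distrib_right sum.distrib)
qed

lemma lin_ext_diff [simp]: "lin_ext g (p - q) = lin_ext g p - lin_ext g q"
  using lin_ext_add[of g "p - q" q] by (simp del: lin_ext_add)

lemma lin_ext_sum: "lin_ext g (\<Sum>i\<in>I. p i) = (\<Sum>i\<in>I. lin_ext g (p i))"
  by (induction I rule: infinite_finite_induct) auto

lemma lin_ext_add_fun: "lin_ext (\<lambda>w. g w + h w) p = lin_ext g p + lin_ext h p"
  by (simp add: lin_ext_def distrib_left sum.distrib)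

lemma sum_keys_single: "(\<Sum>w\<in>Poly_Mapping.keys p. Poly_Mapping.single w (Poly_Mapping.lookup p w)) = p"
  by (rule poly_mapping_eqI)
    (auto simp: lookup_sum lookup_single when_def in_keys_iff if_distrib sum.delta cong: if_cong)

lemma lin_ext_mult_word:
  "lin_ext g (p * q) = (\<Sum>u\<in>Poly_Mapping.keys p. \<Sum>v\<in>Poly_Mapping.keys q.
     Poly_Mapping.lookup p u * Poly_Mapping.lookup q v * g (u + v))"
proof -
  have "p * q = (\<Sum>u\<in>Poly_Mapping.keys p. Poly_Mapping.single u (Poly_Mapping.lookup p u))
      * (\<Sum>v\<in>Poly_Mapping.keys q. Poly_Mapping.single v (Poly_Mapping.lookup q v))"
    by (simp add: sum_keys_single)
  also have "\<dots> = (\<Sum>u\<in>Poly_Mapping.keys p. \<Sum>v\<in>Poly_Mapping.keys q.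
     Poly_Mapping.single (u + v) (Poly_Mapping.lookup p u * Poly_Mapping.lookup q v))"
    by (simp add: sum_product mult_single)
  finally show ?thesis
    by (simp add: lin_ext_sum)
qed

section \<open>Constant and linear part of a differential operator\<close>

definition e22 :: "'f::field ^ 2 ^ 2" where
  "e22 = (\<chi> i j. if i = 2 \<and> j = 2 then 1 else 0)"

text \<open>
  On the multiples of \<open>\<delta>\<close> this is the coefficient of \<open>\<delta>\<close>, for \<open>\<delta> e\<^sub>2\<^sub>2 = e\<^sub>1\<^sub>2 / 2\<close>. Reading it off as a
  matrix entry makes it linear in the operator by its very definition.
\<close>
definition delta_coord :: "('f ^ 2 ^ 2 \<Rightarrow> 'f ^ 2 ^ 2) \<Rightarrow> 'f::field" where
  "delta_coord d = 2 * d e22 $ 1 $ 2"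

lemma delta_coord_mat_scale [simp]:
  "delta_coord (\<lambda>a. mat_scale c (delta a)) = (c :: 'f::field_char_0)"
  by (simp add: delta_coord_def mat_scale_def delta_nth e22_def)

lemma F_deltaE:
  assumes "d \<in> carrier F_delta"
  obtains c where "d = (\<lambda>a. mat_scale c (delta a))"
  using assms by (auto simp: F_delta_def)

lemma delta_coord_add: "delta_coord (l \<oplus>\<^bsub>F_delta\<^esub> m) = delta_coord l + delta_coord m"
  by (simp add: F_delta_def delta_coord_def distrib_left)

lemma delta_coord_smult: "delta_coord (c \<odot>\<^bsub>F_delta\<^esub> l) = c * delta_coord l"
  by (simp add: F_delta_def delta_coord_def mat_scale_def mult_ac)

lemma delta_coord_bracket:
  fixes l m :: "'f::field_char_0 ^ 2 ^ 2 \<Rightarrow> 'f ^ 2 ^ 2"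
  assumes "l \<in> carrier F_delta" "m \<in> carrier F_delta"
  shows "delta_coord (l \<otimes>\<^bsub>F_delta\<^esub> m) = 0"
  using assms
  by (auto elim!: F_deltaE simp: delta_coord_def mat_scale_def delta_nth e22_def)
    (simp add: F_delta_def delta_coord_def mat_scale_def delta_nth e22_def)

text \<open>
  These two functions on words extend linearly to the coefficients of \<open>1\<close> and \<open>\<delta>\<close> of an element of
  the tensor algebra.
\<close>
definition word_const :: "'l list \<Rightarrow> 'f::field" where
  "word_const w = (if w = [] then 1 else 0)"

definition word_lin :: "('f ^ 2 ^ 2 \<Rightarrow> 'f ^ 2 ^ 2) list \<Rightarrow> 'f::field" where
  "word_lin w = (case w of [d] \<Rightarrow> delta_coord d | _ \<Rightarrow> 0)"

lemma word_const_append: "word_const (u @ v) = word_const u * word_const v"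
  by (simp add: word_const_def)

text \<open>
  The two coefficients multiply like dual numbers: together they describe the quotient of the
  polynomial ring in \<open>\<delta>\<close> by the ideal generated by \<open>\<delta>\<^sup>2\<close>.
\<close>
lemma word_lin_append: "word_lin (u @ v) = word_const u * word_lin v + word_lin u * word_const v"
  by (cases u; cases v) (auto simp: word_lin_def word_const_def split: list.splits)

lemma lin_ext_word_const_mult:
  "lin_ext word_const (p * q) = lin_ext word_const p * lin_ext word_const q"
  unfolding lin_ext_mult_word
  by (simp add: plus_list_def word_const_append lin_ext_def sum_product mult_ac)

lemma lin_ext_word_lin_mult:
  "lin_ext word_lin (p * q) =
     lin_ext word_const p * lin_ext word_lin q + lin_ext word_lin p * lin_ext word_const q"
proof -
  have "lin_ext word_lin (p * q) =
      (\<Sum>u\<in>Poly_Mapping.keys p. \<Sum>v\<in>Poly_Mapping.keys q.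
        (Poly_Mapping.lookup p u * word_const u) * (Poly_Mapping.lookup q v * word_lin v)
        + (Poly_Mapping.lookup p u * word_lin u) * (Poly_Mapping.lookup q v * word_const v))"
    unfolding lin_ext_mult_word
    by (intro sum.cong refl) (simp add: plus_list_def word_lin_append algebra_simps)
  then show ?thesis
    by (simp only: sum.distrib lin_ext_def sum_product)
qed

lemma ring_tensor_ring: "ring (tensor_ring L)"
proof (rule ringI)
  show "abelian_group (tensor_ring L)"
  proof (rule abelian_groupI, goal_cases)
    case (6 x)
    then show ?case
      by (intro bexI[of _ "- x"]) (auto simp: tensor_ring_def)
  qed (use Poly_Mapping.keys_add in \<open>fastforce simp: tensor_ring_def algebra_simps\<close>)+
  show "monoid (tensor_ring L)"
  proof (rule monoidI, goal_cases)
    case (1 x y)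
    then show ?case
      using keys_mult[of x y] by (fastforce simp: tensor_ring_def plus_list_def)
  qed (auto simp: tensor_ring_def algebra_simps keys_one zero_list_def)
qed (auto simp: tensor_ring_def algebra_simps)

lemma ideal_env_ideal: "lie_algebra L \<Longrightarrow> ideal (env_ideal L) (tensor_ring L)"
  unfolding env_ideal_def
  by (rule ring.genideal_ideal[OF ring_tensor_ring env_relators_subset])

text \<open>
  The two coefficients descend to the enveloping algebra: by the product rules the elements on which
  both vanish form an ideal, and it contains the relators.
\<close>
lemma env_ideal_parts:
  fixes T :: "('f ^ 2 ^ 2 \<Rightarrow> 'f ^ 2 ^ 2, 'f::field_char_0) free_alg"
  assumes "T \<in> env_ideal F_delta"
  shows "lin_ext word_const T = 0" "lin_ext word_lin T = 0"
proof -
  let ?R = "tensor_ring (F_delta :: ('f, 'f ^ 2 ^ 2 \<Rightarrow> 'f ^ 2 ^ 2) module)"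
  let ?K = "{T \<in> carrier ?R. lin_ext word_const T = 0 \<and> lin_ext word_lin T = 0}"
  interpret R: ring ?R by (rule ring_tensor_ring)
  have inv: "\<ominus>\<^bsub>?R\<^esub> x = - x" if "x \<in> carrier ?R" for x
    by (rule R.minus_equality) (use that in \<open>auto simp: tensor_ring_def\<close>)
  have "ideal ?K ?R"
  proof (rule idealI[OF ring_tensor_ring], goal_cases)
    case 1
    show ?case
    proof (rule R.add.subgroupI, goal_cases)
      case 2
      show ?case by (auto intro!: exI[of _ 0] simp: tensor_ring_def)
    next
      case (3 a)
      then show ?case
        using R.a_inv_closed[of a] lin_ext_diff[of _ 0 a] by (auto simp: inv simp flip: a_inv_def)
    next
      case (4 a b)
      then show ?case
        using R.a_closed[of a b] by (auto simp: tensor_ring_def)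
    qed auto
  next
    case (2 a x)
    then show ?case
      using R.m_closed[of x a]
      by (auto simp: tensor_ring_def lin_ext_word_const_mult lin_ext_word_lin_mult)
  next
    case (3 a x)
    then show ?case
      using R.m_closed[of a x]
      by (auto simp: tensor_ring_def lin_ext_word_const_mult lin_ext_word_lin_mult)
  qed
  moreover have "lin_ext word_const T = 0 \<and> lin_ext word_lin T = 0" if "T \<in> env_relators F_delta"
    for T :: "('f ^ 2 ^ 2 \<Rightarrow> 'f ^ 2 ^ 2, 'f) free_alg"
    using that
    by (auto simp: env_relators_def word_const_def word_lin_def delta_coord_add delta_coord_smult
        delta_coord_bracket)
  then have "env_relators F_delta \<subseteq> ?K"
    using env_relators_subset[OF lie_algebra_F_delta] by blast
  ultimately have "env_ideal F_delta \<subseteq> ?K"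
    unfolding env_ideal_def by (rule R.genideal_minimal)
  with assms show "lin_ext word_const T = 0" "lin_ext word_lin T = 0" by auto
qed

text \<open>
  The choice of the representative is immaterial, see \<open>univ_env_representative\<close>.
\<close>
definition env_const :: "('f, 'f ^ 2 ^ 2 \<Rightarrow> 'f ^ 2 ^ 2) env \<Rightarrow> 'f::field_char_0" where
  "env_const u = lin_ext word_const (SOME T. T \<in> u)"

definition env_lin :: "('f, 'f ^ 2 ^ 2 \<Rightarrow> 'f ^ 2 ^ 2) env \<Rightarrow> 'f::field_char_0" where
  "env_lin u = lin_ext word_lin (SOME T. T \<in> u)"

lemma carrier_univ_env:
  "carrier (univ_env L) = {env_ideal L +>\<^bsub>tensor_ring L\<^esub> T | T. T \<in> carrier (tensor_ring L)}"
  by (auto simp: univ_env_def Let_def FactRing_def A_RCOSETS_def' a_r_coset_def')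

lemma mem_env_coset: "S \<in> env_ideal L +>\<^bsub>tensor_ring L\<^esub> T \<longleftrightarrow> S - T \<in> env_ideal L"
  by (auto simp: a_r_coset_def' tensor_ring_def intro!: bexI[of _ "S - T"])

lemma self_in_env_coset: "lie_algebra L \<Longrightarrow> T \<in> env_ideal L +>\<^bsub>tensor_ring L\<^esub> T"
  using additive_subgroup.zero_closed[OF ideal.axioms(1)[OF ideal_env_ideal], of L]
  unfolding mem_env_coset by (simp add: tensor_ring_def)

lemma univ_env_representative:
  fixes u :: "('f::field_char_0, 'f ^ 2 ^ 2 \<Rightarrow> 'f ^ 2 ^ 2) env"
  assumes "u \<in> carrier (univ_env F_delta)"
  shows "u \<noteq> {}"
    and "T \<in> u \<Longrightarrow> T \<in> carrier (tensor_ring F_delta)"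
    and "T \<in> u \<Longrightarrow> lin_ext word_const T = env_const u"
    and "T \<in> u \<Longrightarrow> lin_ext word_lin T = env_lin u"
proof -
  let ?R = "tensor_ring (F_delta :: ('f, 'f ^ 2 ^ 2 \<Rightarrow> 'f ^ 2 ^ 2) module)"
  interpret I: ideal "env_ideal F_delta" ?R
    by (rule ideal_env_ideal[OF lie_algebra_F_delta])
  from assms obtain S where S: "S \<in> carrier ?R" "u = env_ideal F_delta +>\<^bsub>?R\<^esub> S"
    by (auto simp: carrier_univ_env)
  have S_in: "S \<in> u"
    unfolding S(2) by (rule self_in_env_coset[OF lie_algebra_F_delta])
  then show "u \<noteq> {}" by auto
  have parts: "lin_ext word_const T = lin_ext word_const S \<and> lin_ext word_lin T = lin_ext word_lin S"
    if "T \<in> u" for T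
    using that env_ideal_parts[of "T - S"] by (simp add: S(2) mem_env_coset)
  have some: "(SOME T. T \<in> u) \<in> u" using S_in by (rule someI)
  assume T: "T \<in> u"
  then show "T \<in> carrier ?R"
    using subsetD[OF I.a_r_coset_subset_G[OF I.a_subset S(1)]] by (simp add: S(2))
  show "lin_ext word_const T = env_const u" "lin_ext word_lin T = env_lin u"
    using parts[OF T] parts[OF some] by (simp_all add: env_const_def env_lin_def)
qed

lemma env_parts_coset:
  fixes T :: "('f ^ 2 ^ 2 \<Rightarrow> 'f ^ 2 ^ 2, 'f::field_char_0) free_alg"
  assumes "T \<in> carrier (tensor_ring F_delta)"
  shows "env_const (env_ideal F_delta +>\<^bsub>tensor_ring F_delta\<^esub> T) = lin_ext word_const T"
    and "env_lin (env_ideal F_delta +>\<^bsub>tensor_ring F_delta\<^esub> T) = lin_ext word_lin T"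
proof -
  have "env_ideal F_delta +>\<^bsub>tensor_ring F_delta\<^esub> T \<in> carrier (univ_env F_delta)"
    using assms by (auto simp: carrier_univ_env)
  from univ_env_representative(3,4)[OF this self_in_env_coset[OF lie_algebra_F_delta]]
  show "env_const (env_ideal F_delta +>\<^bsub>tensor_ring F_delta\<^esub> T) = lin_ext word_const T"
    and "env_lin (env_ideal F_delta +>\<^bsub>tensor_ring F_delta\<^esub> T) = lin_ext word_lin T"
    by simp_all
qed

lemma env_parts_one:
  "env_const (\<one>\<^bsub>univ_env (F_delta :: ('f::field_char_0, _) module)\<^esub>) = 1"
  "env_lin (\<one>\<^bsub>univ_env (F_delta :: ('f::field_char_0, _) module)\<^esub>) = 0"
proof -
  let ?R = "tensor_ring (F_delta :: ('f, 'f ^ 2 ^ 2 \<Rightarrow> 'f ^ 2 ^ 2) module)"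
  have one: "\<one>\<^bsub>univ_env F_delta\<^esub> = env_ideal F_delta +>\<^bsub>?R\<^esub> Poly_Mapping.single [] 1"
    using single_one[where 'a = "('f ^ 2 ^ 2 \<Rightarrow> 'f ^ 2 ^ 2) list" and 'b = 'f]
    by (simp add: univ_env_def Let_def FactRing_def tensor_ring_def zero_list_def)
  have "Poly_Mapping.single [] 1 \<in> carrier ?R"
    by (simp add: tensor_ring_def)
  then show "env_const (\<one>\<^bsub>univ_env (F_delta :: ('f, _) module)\<^esub>) = 1"
    and "env_lin (\<one>\<^bsub>univ_env (F_delta :: ('f, _) module)\<^esub>) = 0"
    unfolding one by (simp_all add: env_parts_coset word_const_def word_lin_def)
qed

text \<open>
  The linear coefficient is a nonzero linear functional on the enveloping algebra, as it takes the
  value 1 at \<open>\<delta>\<close>; therefore it cannot vanish on a basis.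
\<close>
lemma basis_env_lin:
  fixes B :: "('f::field_char_0, 'f ^ 2 ^ 2 \<Rightarrow> 'f ^ 2 ^ 2) env set"
  assumes "is_basis (univ_env F_delta) B"
  obtains h where "h \<in> B" "env_lin h \<noteq> 0"
proof (rule ccontr)
  let ?L = "F_delta :: ('f, 'f ^ 2 ^ 2 \<Rightarrow> 'f ^ 2 ^ 2) module"
  let ?R = "tensor_ring ?L" and ?U = "univ_env ?L" and ?I = "env_ideal ?L"
  assume "\<not> thesis"
  then have B0: "env_lin h = 0" if "h \<in> B" for h
    using that \<open>\<And>h. \<lbrakk>h \<in> B; env_lin h \<noteq> 0\<rbrakk> \<Longrightarrow> thesis\<close> by blast
  have BU: "B \<subseteq> carrier ?U" using assms by (simp add: is_basis_def)
  interpret I: ideal ?I ?R by (rule ideal_env_ideal[OF lie_algebra_F_delta])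
  interpret Q: ring "?R Quot ?I" by (rule I.quotient_is_ring)
  have U_Q: "carrier ?U = carrier (?R Quot ?I)" "add ?U = add (?R Quot ?I)"
    "zero ?U = zero (?R Quot ?I)" "mult ?U = mult (?R Quot ?I)"
    by (simp_all add: univ_env_def Let_def)
  have "abelian_monoid ?U"
    by (rule abelian_monoidI) (simp_all add: U_Q Q.a_ac)
  then interpret U: abelian_monoid ?U .
  have add_lin: "env_lin (u \<oplus>\<^bsub>?U\<^esub> v) = env_lin u + env_lin v"
    if u: "u \<in> carrier ?U" and v: "v \<in> carrier ?U" for u v
  proof -
    obtain S T where "S \<in> u" "T \<in> v"
      using univ_env_representative(1) u v by blast
    then have "S + T \<in> u \<oplus>\<^bsub>?U\<^esub> v"
      by (auto simp: univ_env_def Let_def FactRing_def set_add_def' tensor_ring_def)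
    with \<open>S \<in> u\<close> \<open>T \<in> v\<close> univ_env_representative(4) u v U.a_closed[OF u v] lin_ext_add
    show ?thesis by metis
  qed
  have smult_closed: "c \<odot>\<^bsub>?U\<^esub> u \<in> carrier ?U" and smult_lin: "env_lin (c \<odot>\<^bsub>?U\<^esub> u) = c * env_lin u"
    if u: "u \<in> carrier ?U" for c u
  proof -
    let ?c = "Poly_Mapping.single [] c"
    have c: "?c \<in> carrier ?R" by (simp add: tensor_ring_def)
    obtain T where T: "T \<in> carrier ?R" "u = ?I +>\<^bsub>?R\<^esub> T"
      using u by (auto simp: carrier_univ_env)
    have eq: "c \<odot>\<^bsub>?U\<^esub> u = ?I +>\<^bsub>?R\<^esub> (?c \<otimes>\<^bsub>?R\<^esub> T)"
      using I.rcoset_mult_add[OF c T(1)] by (simp add: T(2) univ_env_def Let_def FactRing_def)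
    have m: "?c \<otimes>\<^bsub>?R\<^esub> T \<in> carrier ?R" using I.m_closed[OF c T(1)] .
    show "c \<odot>\<^bsub>?U\<^esub> u \<in> carrier ?U"
      using m by (auto simp: eq carrier_univ_env)
    show "env_lin (c \<odot>\<^bsub>?U\<^esub> u) = c * env_lin u"
    proof -
      have "env_lin (c \<odot>\<^bsub>?U\<^esub> u) = lin_ext word_lin (?c \<otimes>\<^bsub>?R\<^esub> T)"
        by (simp only: eq env_parts_coset(2)[OF m])
      moreover have "env_lin u = lin_ext word_lin T"
        by (simp only: T(2) env_parts_coset(2)[OF T(1)])
      ultimately show ?thesis
        by (simp add: tensor_ring_def lin_ext_word_lin_mult word_const_def word_lin_def)
    qed
  qed
  \<comment> \<open>If the functional vanished on \<open>B\<close>, it would vanish on every linear combination of \<open>B\<close>.\<close>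
  have sum_lin: "env_lin (\<Oplus>\<^bsub>?U\<^esub>b\<in>K. c b \<odot>\<^bsub>?U\<^esub> b) = 0" if "finite K" "K \<subseteq> B" for K and c :: "_ \<Rightarrow> 'f"
    using that
  proof (induction K rule: finite_induct)
    case empty
    have "env_lin (\<zero>\<^bsub>?U\<^esub>) = env_lin (\<zero>\<^bsub>?U\<^esub>) + env_lin (\<zero>\<^bsub>?U\<^esub>)"
      using add_lin[of "\<zero>\<^bsub>?U\<^esub>" "\<zero>\<^bsub>?U\<^esub>"] by simp
    then show ?case by simp
  next
    case (insert b K)
    have clos: "(\<lambda>b. c b \<odot>\<^bsub>?U\<^esub> b) \<in> insert b K \<rightarrow> carrier ?U"
      using insert.prems BU smult_closed by blast
    then have "(\<Oplus>\<^bsub>?U\<^esub>b\<in>K. c b \<odot>\<^bsub>?U\<^esub> b) \<in> carrier ?U"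
      by (intro U.finsum_closed) auto
    moreover have "b \<in> carrier ?U" "b \<in> B" using insert.prems BU by auto
    ultimately show ?case
      using insert clos by (simp add: add_lin smult_closed smult_lin B0)
  qed
  let ?d = "Poly_Mapping.single [delta] 1 :: ('f ^ 2 ^ 2 \<Rightarrow> 'f ^ 2 ^ 2, 'f) free_alg"
  have coord: "delta_coord (delta :: 'f ^ 2 ^ 2 \<Rightarrow> 'f ^ 2 ^ 2) = 1"
    by (simp add: delta_coord_def delta_nth e22_def)
  have "delta \<in> carrier ?L"
    by (auto simp: F_delta_def mat_scale_def vec_eq_iff fun_eq_iff intro!: exI[of _ 1])
  then have d: "?d \<in> carrier ?R"
    by (simp add: tensor_ring_def)
  then have "?I +>\<^bsub>?R\<^esub> ?d \<in> carrier ?U"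
    by (auto simp: carrier_univ_env)
  with assms obtain c :: "_ \<Rightarrow>\<^sub>0 'f" where "Poly_Mapping.keys c \<subseteq> B"
    "?I +>\<^bsub>?R\<^esub> ?d = (\<Oplus>\<^bsub>?U\<^esub>b\<in>Poly_Mapping.keys c. Poly_Mapping.lookup c b \<odot>\<^bsub>?U\<^esub> b)"
    unfolding is_basis_def by blast
  then have "env_lin (?I +>\<^bsub>?R\<^esub> ?d) = 0"
    using sum_lin[of "Poly_Mapping.keys c" "Poly_Mapping.lookup c"] by simp
  with env_parts_coset(2)[OF d] coord show False
    by (simp add: word_lin_def)
qed

section \<open>Copies of the algebra of triangular matrices with a rescaled derivation\<close>

lemma mat_scale_one: "mat_scale 1 a = a"
  by (simp add: mat_scale_def)

lemma mat_scale_zero: "mat_scale 0 a = 0"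
  by (simp add: mat_scale_def vec_eq_iff)

text \<open>
  Moving the algebra along an injection \<open>emb\<close> allows copies of it inside the type that varieties are
  made of; the parameter \<open>t\<close> covers both the given action (\<open>t = 1\<close>) and the trivial one (\<open>t = 0\<close>).
\<close>
definition scaled_UT2 :: "('f ^ 2 ^ 2 \<Rightarrow> 'b) \<Rightarrow> 'f::field_char_0 \<Rightarrow> ('f, 'b, 'f ^ 2 ^ 2 \<Rightarrow> 'f ^ 2 ^ 2) l_alg"
  where
  "scaled_UT2 emb t = \<lparr>carrier = emb ` {a. a $ 2 $ 1 = 0},
     mult = (\<lambda>x y. emb (the_inv emb x ** the_inv emb y)), one = emb (mat 1), zero = emb 0,
     add = (\<lambda>x y. emb (the_inv emb x + the_inv emb y)), smult = (\<lambda>c x. emb (mat_scale c (the_inv emb x))),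
     act = (\<lambda>d x. emb (mat_scale t (d (the_inv emb x))))\<rparr>"

declare the_inv_f_f [simp]

lemma scaled_UT2_id_1: "scaled_UT2 id 1 = (UT2_delta :: ('f::field_char_0, _, _) l_alg)"
proof -
  have "the_inv id x = x" for x :: "'f ^ 2 ^ 2"
    using the_inv_f_f[of id x] by simp
  then show ?thesis
    by (simp add: scaled_UT2_def UT2_delta_def mat_scale_one)
qed

lemma L_algebra_scaled_UT2:
  fixes emb :: "'f::field_char_0 ^ 2 ^ 2 \<Rightarrow> 'b"
  assumes "inj emb"
  shows "L_algebra F_delta (scaled_UT2 emb t)"
proof -
  let ?A = "scaled_UT2 emb t"
  have [simp]: "the_inv emb (emb a) = a" for a
    using assms by simp
  have [simp]: "emb a = emb b \<longleftrightarrow> a = b" for a b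
    using assms by (simp add: inj_eq)
  note A_simps = scaled_UT2_def field_ring_def mat_scale_def vec_eq_iff algebra_simps
  have ag: "abelian_group ?A"
  proof (rule abelian_groupI, goal_cases)
    case (6 x)
    then obtain a where "a $ 2 $ 1 = 0" "x = emb a" by (auto simp: scaled_UT2_def)
    then show ?case by (intro bexI[of _ "emb (- a)"]) (auto simp: scaled_UT2_def)
  qed (auto simp: scaled_UT2_def algebra_simps)
  interpret M: Module.module field_ring ?A
    by (rule Module.moduleI[OF cring_field_ring ag]) (auto simp: A_simps)
  interpret A: assoc_algebra ?A
    by unfold_locales (auto simp: A_simps matrix_matrix_mult_def sum_2)
  interpret L: lie_algebra "F_delta :: ('f, 'f ^ 2 ^ 2 \<Rightarrow> 'f ^ 2 ^ 2) module"
    by (rule lie_algebra_F_delta)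
  have inv: "\<ominus>\<^bsub>?A\<^esub> emb a = emb (- a)" if "a $ 2 $ 1 = 0" for a
    by (rule abelian_group.minus_equality[OF ag]) (use that in \<open>auto simp: scaled_UT2_def\<close>)
  show ?thesis
  proof (unfold_locales, goal_cases)
    case (7 l m x)
    then obtain a where "a $ 2 $ 1 = 0" "x = emb a" by (auto simp: scaled_UT2_def)
    then have acts: "act ?A l (act ?A m x) = emb 0" "act ?A m (act ?A l x) = emb 0"
        "act ?A (l \<otimes>\<^bsub>F_delta\<^esub> m) x = emb 0"
      using 7 by (auto elim!: F_deltaE
        simp: scaled_UT2_def mat_scale_def delta_nth vec_eq_iff)
        (auto simp: F_delta_def mat_scale_def delta_nth)
    show ?case
      unfolding acts by (simp add: a_minus_def inv) (simp add: scaled_UT2_def)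
  qed (auto elim!: F_deltaE simp: scaled_UT2_def mat_scale_def vec_eq_iff delta_nth field_simps
       matrix_matrix_mult_def sum_2 forall_2, (simp_all add: F_delta_def mat_scale_def field_simps)?)
qed

lemma finsum_scaled_UT2:
  assumes "inj emb" "finite K" "\<And>w. w \<in> K \<Longrightarrow> g w $ 2 $ 1 = 0"
  shows "(\<Oplus>\<^bsub>scaled_UT2 emb t\<^esub>w\<in>K. emb (g w)) = emb (\<Sum>w\<in>K. g w)"
proof -
  interpret L_algebra F_delta "scaled_UT2 emb t"
    by (rule L_algebra_scaled_UT2) fact
  show ?thesis
    using assms(2,3)
  proof (induction K rule: finite_induct)
    case (insert w K)
    have "(\<lambda>w. emb (g w)) \<in> insert w K \<rightarrow> carrier (scaled_UT2 emb t)"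
      using insert.prems by (auto simp: scaled_UT2_def)
    then have "(\<Oplus>\<^bsub>scaled_UT2 emb t\<^esub>w\<in>insert w K. emb (g w)) = emb (g w) \<oplus>\<^bsub>scaled_UT2 emb t\<^esub> emb (\<Sum>w\<in>K. g w)"
      using insert by (subst A.finsum_insert) auto
    then show ?case
      using insert assms(1) by (simp add: scaled_UT2_def)
  next
    case empty
    show ?case by simp (simp add: scaled_UT2_def)
  qed
qed

text \<open>
  Words of length two or more act as zero because \<open>\<delta> (\<delta> a) = 0\<close> for triangular \<open>a\<close>.
\<close>
lemma foldr_act_scaled_UT2:
  assumes "inj emb" "a $ 2 $ 1 = 0" "set w \<subseteq> carrier F_delta"
  shows "foldr (act (scaled_UT2 emb t)) w (emb a) =
    emb (mat_scale (word_const w) a + mat_scale (t * word_lin w) (delta a))"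
  using assms(3)
proof (induction w)
  case Nil
  show ?case by (simp add: word_const_def word_lin_def mat_scale_one mat_scale_zero)
next
  case (Cons d w)
  then obtain c where d: "d = (\<lambda>a. mat_scale c (delta a))" by (auto elim: F_deltaE)
  have "word_lin (d # w) = c * word_const w"
    by (cases w) (simp_all add: word_lin_def word_const_def d)
  moreover have "mat_scale t (mat_scale c (delta (mat_scale p a + mat_scale q (delta a)))) =
      mat_scale (t * (c * p)) (delta a)" for p q
    using assms(2) by (simp add: mat_scale_def delta_nth vec_eq_iff forall_2 algebra_simps)
  ultimately show ?case
    using Cons assms(1) by (simp add: scaled_UT2_def d word_const_def mat_scale_zero)
qed

lemma env_act_scaled_UT2:
  fixes h :: "('f::field_char_0, 'f ^ 2 ^ 2 \<Rightarrow> 'f ^ 2 ^ 2) env"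
  assumes emb: "inj emb" and a: "a $ 2 $ 1 = 0" and h: "h \<in> carrier (univ_env F_delta)"
  shows "env_act (scaled_UT2 emb t) h (emb a) =
    emb (mat_scale (env_const h) a + mat_scale (t * env_lin h) (delta a))"
proof -
  have "tensor_act (scaled_UT2 emb t) T (emb a) =
      emb (mat_scale (env_const h) a + mat_scale (t * env_lin h) (delta a))" if T: "T \<in> h" for T
  proof -
    let ?v = "\<lambda>w. mat_scale (Poly_Mapping.lookup T w)
      (mat_scale (word_const w) a + mat_scale (t * word_lin w) (delta a))"
    have w: "set w \<subseteq> carrier F_delta" if "w \<in> Poly_Mapping.keys T" for w
      using univ_env_representative(2)[OF h T] that by (simp add: tensor_ring_def)
    have up: "?v w $ 2 $ 1 = 0" for w
      by (simp add: mat_scale_def delta_nth a)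
    interpret L_algebra F_delta "scaled_UT2 emb t"
      by (rule L_algebra_scaled_UT2) fact
    have "tensor_act (scaled_UT2 emb t) T (emb a) =
        (\<Oplus>\<^bsub>scaled_UT2 emb t\<^esub>w\<in>Poly_Mapping.keys T. emb (?v w))"
      unfolding tensor_act_def
      by (intro A.finsum_cong' refl)
        (use emb up in \<open>auto simp: foldr_act_scaled_UT2[OF emb a w], auto simp: scaled_UT2_def\<close>)
    also have "\<dots> = emb (\<Sum>w\<in>Poly_Mapping.keys T. ?v w)"
      by (rule finsum_scaled_UT2[OF emb _ up]) simp
    also have "(\<Sum>w\<in>Poly_Mapping.keys T. ?v w) =
        mat_scale (lin_ext word_const T) a + mat_scale (t * lin_ext word_lin T) (delta a)"
      by (simp add: vec_eq_iff mat_scale_def lin_ext_def sum_distrib_left sum_distrib_right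
          algebra_simps sum.distrib)
    finally show ?thesis
      by (simp add: univ_env_representative(3,4)[OF h T])
  qed
  with univ_env_representative(1)[OF h] show ?thesis
    unfolding env_act_def by (intro the_equality) auto
qed

definition letter_value :: "'f \<Rightarrow> (nat \<Rightarrow> 'f ^ 2 ^ 2) \<Rightarrow>
    nat \<times> ('f, 'f ^ 2 ^ 2 \<Rightarrow> 'f ^ 2 ^ 2) env \<Rightarrow> 'f::field_char_0 ^ 2 ^ 2" where
  "letter_value t a x = mat_scale (env_const (snd x)) (a (fst x))
     + mat_scale (t * env_lin (snd x)) (delta (a (fst x)))"

text \<open>
  The product is formed in the original algebra of matrices, so that values for different \<open>t\<close>
  and different embeddings can be compared.
\<close>
definition word_value :: "'f \<Rightarrow> (nat \<Rightarrow> 'f ^ 2 ^ 2) \<Rightarrow>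
    (nat \<times> ('f, 'f ^ 2 ^ 2 \<Rightarrow> 'f ^ 2 ^ 2) env) list \<Rightarrow> 'f::field_char_0 ^ 2 ^ 2" where
  "word_value t a w = word_prod UT2_delta (map (letter_value t a) w)"

lemma word_value_simps [simp]:
  "word_value t a [] = 0"
  "word_value t a [x] = letter_value t a x"
  "word_value t a (x # y # w) = letter_value t a x ** word_value t a (y # w)"
  by (simp_all add: word_value_def UT2_delta_def)

lemma letter_value_nth:
  assumes "a (fst x) $ 2 $ 1 = 0"
  shows "letter_value t a x $ 1 $ 1 = env_const (snd x) * a (fst x) $ 1 $ 1"
    and "letter_value t a x $ 2 $ 2 = env_const (snd x) * a (fst x) $ 2 $ 2"
    and "letter_value t a x $ 2 $ 1 = 0"
    and "letter_value t a x $ 1 $ 2 = env_const (snd x) * a (fst x) $ 1 $ 2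
      + t * env_lin (snd x) * ((a (fst x) $ 2 $ 2 - a (fst x) $ 1 $ 1) / 2)"
  using assms by (simp_all add: letter_value_def mat_scale_def delta_nth)

lemma word_value_upper:
  "(\<And>j. a j $ 2 $ 1 = 0) \<Longrightarrow> word_value t a w $ 2 $ 1 = 0"
  by (induction w rule: induct_list012)
    (simp_all add: letter_value_nth matrix_matrix_mult_def sum_2)

definition diag_part :: "'f::field ^ 2 ^ 2 \<Rightarrow> 'f ^ 2 ^ 2" where
  "diag_part a = (\<chi> i k. if i = k then a $ i $ k else 0)"

lemma diag_part_nth [simp]: "diag_part a $ i $ k = (if i = k then a $ i $ k else 0)"
  by (simp add: diag_part_def)

text \<open>
  Taking a diagonal entry is multiplicative on triangular matrices, and \<open>\<delta>\<close> does not contribute to it.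
\<close>
lemma word_value_diagonal:
  assumes "\<And>j. a j $ 2 $ 1 = 0"
  shows "word_value t a w $ 1 $ 1 = word_value s (\<lambda>j. diag_part (a j)) w $ 1 $ 1
    \<and> word_value t a w $ 2 $ 2 = word_value s (\<lambda>j. diag_part (a j)) w $ 2 $ 2"
  using assms
  by (induction w rule: induct_list012)
    (auto simp: letter_value_nth matrix_matrix_mult_def sum_2 word_value_upper)

text \<open>
  The corner entry of a product of triangular matrices is a sum of terms that each contain the corner
  entry of exactly one factor. The corner entry of a letter is the sum of a multiple of the entry of
  \<open>a\<close>, which is its value for \<open>t = 0\<close>, and a term in the diagonal of \<open>a\<close>, which is its value at the
  diagonal part.
\<close>
lemma word_value_corner:
  assumes a: "\<And>j. a j $ 2 $ 1 = 0"
  shows "word_value t a w $ 1 $ 2 = word_value 0 a w $ 1 $ 2 + word_value t (\<lambda>j. diag_part (a j)) w $ 1 $ 2"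
proof (induction w rule: induct_list012)
  case (3 x y w)
  have "word_value t a (y # w) $ 2 $ 2 = word_value t (\<lambda>j. diag_part (a j)) (y # w) $ 2 $ 2"
    "word_value 0 a (y # w) $ 2 $ 2 = word_value t (\<lambda>j. diag_part (a j)) (y # w) $ 2 $ 2"
    using word_value_diagonal[where a = a, OF a] by blast+
  with "3.IH"(2) show ?case
    using a by (simp add: letter_value_nth matrix_matrix_mult_def sum_2 field_simps)
qed (use a in \<open>simp_all add: letter_value_nth\<close>)

lemma dp_eval_scaled_UT2:
  assumes emb: "inj emb" and a: "\<And>j. a j $ 2 $ 1 = 0" and B: "B \<subseteq> carrier (univ_env F_delta)"
    and f: "f \<in> diff_polys B"
  shows "dp_eval (scaled_UT2 emb t) (\<lambda>j. emb (a j)) f = emb (\<chi> i k. lin_ext (\<lambda>w. word_value t a w $ i $ k) f)"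
proof -
  let ?A = "scaled_UT2 emb t"
  let ?v = "\<lambda>w. mat_scale (Poly_Mapping.lookup f w) (word_value t a w)"
  interpret L_algebra F_delta ?A
    by (rule L_algebra_scaled_UT2) fact
  have letter: "env_act ?A (snd x) (emb (a (fst x))) = emb (letter_value t a x)" if "snd x \<in> B" for x
    using that B by (simp add: env_act_scaled_UT2[OF emb a] letter_value_def subset_iff)
  have word: "word_prod ?A (map (\<lambda>(j, h). env_act ?A h (emb (a j))) w) = emb (word_value t a w)"
    if "snd ` set w \<subseteq> B" for w
    using that
  proof (induction w rule: induct_list012)
    case (3 x y w)
    then show ?case
      using emb by (simp add: case_prod_beta letter) (simp add: scaled_UT2_def)
  qed (simp_all add: case_prod_beta letter, simp add: scaled_UT2_def)
  have up: "?v w $ 2 $ 1 = 0" for w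
    by (simp add: mat_scale_def word_value_upper[OF a])
  have "dp_eval ?A (\<lambda>j. emb (a j)) f = (\<Oplus>\<^bsub>?A\<^esub>w\<in>Poly_Mapping.keys f. emb (?v w))"
    unfolding dp_eval_def
  proof (intro A.finsum_cong' refl)
    show "(\<lambda>w. emb (?v w)) \<in> Poly_Mapping.keys f \<rightarrow> carrier ?A"
      using up by (auto simp: scaled_UT2_def)
  next
    fix w
    assume "w \<in> Poly_Mapping.keys f"
    with f have "set w \<subseteq> UNIV \<times> B" by (simp add: diff_polys_def)
    then have "snd ` set w \<subseteq> B" by auto
    from word[OF this] show "Poly_Mapping.lookup f w \<odot>\<^bsub>?A\<^esub>
        word_prod ?A (map (\<lambda>(j, h). env_act ?A h (emb (a j))) w) = emb (?v w)"
      using emb by (simp add: scaled_UT2_def)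
  qed
  also have "\<dots> = emb (\<Sum>w\<in>Poly_Mapping.keys f. ?v w)"
    by (rule finsum_scaled_UT2[OF emb _ up]) simp
  also have "(\<Sum>w\<in>Poly_Mapping.keys f. ?v w) = (\<chi> i k. lin_ext (\<lambda>w. word_value t a w $ i $ k) f)"
    by (simp add: vec_eq_iff mat_scale_def lin_ext_def)
  finally show ?thesis .
qed

text \<open>
  This translates identities of the copies into scalar equations over one and the same algebra of
  matrices, in which algebras over different types can be compared.
\<close>
lemma Id_L_scaled_UT2:
  fixes emb :: "'f::field_char_0 ^ 2 ^ 2 \<Rightarrow> 'b"
  assumes emb: "inj emb" and B: "B \<subseteq> carrier (univ_env F_delta)"
  shows "f \<in> Id_L B (scaled_UT2 emb t) \<longleftrightarrow> f \<in> diff_polys B \<and>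
    (\<forall>a. (\<forall>j. a j $ 2 $ 1 = 0) \<longrightarrow> (\<forall>i k. lin_ext (\<lambda>w. word_value t a w $ i $ k) f = 0))"
    (is "_ \<longleftrightarrow> _ \<and> ?R")
proof (cases "f \<in> diff_polys B")
  case True
  have "(\<forall>a. (\<forall>j. a j \<in> carrier (scaled_UT2 emb t)) \<longrightarrow>
      dp_eval (scaled_UT2 emb t) a f = \<zero>\<^bsub>scaled_UT2 emb t\<^esub>) \<longleftrightarrow>
    (\<forall>a. (\<forall>j. a j $ 2 $ 1 = 0) \<longrightarrow>
      dp_eval (scaled_UT2 emb t) (\<lambda>j. emb (a j)) f = \<zero>\<^bsub>scaled_UT2 emb t\<^esub>)" (is "?P \<longleftrightarrow> ?Q")
  proof
    assume ?P
    then show ?Q by (auto simp: scaled_UT2_def)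
  next
    assume Q: ?Q
    show ?P
    proof (intro allI impI)
      fix x :: "nat \<Rightarrow> 'b"
      assume "\<forall>j. x j \<in> carrier (scaled_UT2 emb t)"
      \<comment> \<open>Every assignment in the copy comes from an assignment of triangular matrices.\<close>
      then have "\<forall>j. \<exists>a. a $ 2 $ 1 = 0 \<and> x j = emb a" by (auto simp: scaled_UT2_def)
      then obtain a where "\<And>j. a j $ 2 $ 1 = 0" "x = (\<lambda>j. emb (a j))" by metis
      with Q show "dp_eval (scaled_UT2 emb t) x f = \<zero>\<^bsub>scaled_UT2 emb t\<^esub>" by simp
    qed
  qed
  also have "?Q \<longleftrightarrow> ?R"
    by (auto simp: dp_eval_scaled_UT2[OF emb _ B True])
      (use emb in \<open>auto simp: scaled_UT2_def inj_eq vec_eq_iff\<close>)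
  finally show ?thesis
    using True by (simp add: Id_L_def)
qed (simp add: Id_L_def)

lemma Id_L_scaled_UT2_1:
  fixes emb :: "'f::field_char_0 ^ 2 ^ 2 \<Rightarrow> 'b"
  assumes "inj emb" "B \<subseteq> carrier (univ_env F_delta)"
  shows "Id_L B (scaled_UT2 emb 1) = Id_L B UT2_delta"
  unfolding scaled_UT2_id_1[symmetric] set_eq_iff Id_L_scaled_UT2[OF assms]
    Id_L_scaled_UT2[OF inj_on_id assms(2)] by simp

text \<open>
  The corner entry for \<open>t = 0\<close> is the difference of two corner entries for \<open>t = 1\<close>, one at the given
  arguments and one at their diagonal parts, and both of these vanish on an identity of
  \<open>UT2_delta\<close>.
\<close>
lemma Id_L_UT2_delta_subset:
  fixes emb :: "'f::field_char_0 ^ 2 ^ 2 \<Rightarrow> 'b"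
  assumes emb: "inj emb" and B: "B \<subseteq> carrier (univ_env F_delta)"
  shows "Id_L B UT2_delta \<subseteq> Id_L B (scaled_UT2 emb 0)"
proof
  fix f
  assume "f \<in> Id_L B UT2_delta"
  then have f: "f \<in> diff_polys B"
    and *: "\<And>a i k. (\<And>j. a j $ 2 $ 1 = 0) \<Longrightarrow> lin_ext (\<lambda>w. word_value 1 a w $ i $ k) f = 0"
    by (auto simp: Id_L_scaled_UT2[OF _ B] simp flip: scaled_UT2_id_1)
  have "lin_ext (\<lambda>w. word_value 0 a w $ i $ k) f = 0" if a: "\<And>j. a j $ 2 $ 1 = 0" for a i k
  proof -
    have "lin_ext (\<lambda>w. word_value 0 a w $ 1 $ 1) f = 0" "lin_ext (\<lambda>w. word_value 0 a w $ 2 $ 2) f = 0"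
      using word_value_diagonal[where a = a, OF a, where t = 0 and s = 1]
        *[of "\<lambda>j. diag_part (a j)"] by simp_all
    moreover have "lin_ext (\<lambda>w. word_value 0 a w $ 1 $ 2) f = 0"
      using *[of a, OF a, of 1 2] *[of "\<lambda>j. diag_part (a j)", of 1 2]
      unfolding word_value_corner[where a = a, OF a, where t = 1] lin_ext_add_fun by simp
    moreover have "lin_ext (\<lambda>w. word_value 0 a w $ 2 $ 1) f = 0"
      by (simp add: word_value_upper[OF a]) (simp add: lin_ext_def)
    ultimately show ?thesis
      using exhaust_2[of i] exhaust_2[of k] by auto
  qed
  with f show "f \<in> Id_L B (scaled_UT2 emb 0)"
    by (simp add: Id_L_scaled_UT2[OF emb B])
qed

section \<open>Exponential growth of the codimensions\<close>

lemma lin_ext_fa_scale: "lin_ext g (fa_scale c p) = c * lin_ext g p"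
  by (simp add: fa_scale_def lin_ext_mult_word plus_list_def)
    (simp add: lin_ext_def sum_distrib_left mult_ac)

text \<open>
  A family with a dual family of functionals that vanish on \<open>W\<close> is independent modulo \<open>W\<close>.
\<close>
lemma quotient_dim_ge:
  assumes "finite I" "\<And>i. i \<in> I \<Longrightarrow> m i \<in> P"
    and dual: "\<And>i j. \<lbrakk>i \<in> I; j \<in> I\<rbrakk> \<Longrightarrow> lin_ext (g i) (m j) = (if i = j then 1 else 0)"
    and W: "\<And>i f. \<lbrakk>i \<in> I; f \<in> W\<rbrakk> \<Longrightarrow> lin_ext (g i) f = 0"
  shows "enat (card I) \<le> quotient_dim P W"
proof -
  have "inj_on m I"
  proof (rule inj_onI)
    fix i j
    assume "i \<in> I" "j \<in> I" "m i = m j"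
    with dual[of i j] dual[of i i] show "i = j" by (auto split: if_splits)
  qed
  then have card: "card (m ` I) = card I" by (rule card_image)
  have "u s = 0" if s: "s \<in> m ` I" and sum: "(\<Sum>s\<in>m ` I. fa_scale (u s) s) \<in> W" for u s
  proof -
    from s obtain i where i: "i \<in> I" "s = m i" by blast
    have "0 = lin_ext (g i) (\<Sum>s\<in>m ` I. fa_scale (u s) s)"
      using W[OF i(1) sum] by simp
    also have "\<dots> = (\<Sum>j\<in>I. u (m j) * lin_ext (g i) (m j))"
      using \<open>inj_on m I\<close> by (simp add: lin_ext_sum lin_ext_fa_scale sum.reindex)
    also have "\<dots> = (\<Sum>j\<in>I. if j = i then u (m j) else 0)"
      using i(1) dual by (intro sum.cong) auto
    also have "\<dots> = u s"
      using i assms(1) by simp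
    finally show ?thesis by simp
  qed
  then have "enat (card (m ` I)) \<le> quotient_dim P W"
    unfolding quotient_dim_def using assms(1,2) by (intro SUP_upper) auto
  then show ?thesis by (simp add: card)
qed

definition split_word :: "nat \<Rightarrow> nat set \<Rightarrow> nat list" where
  "split_word n K = filter (\<lambda>j. j \<in> K) [2..<Suc n] @ 1 # filter (\<lambda>j. j \<notin> K) [2..<Suc n]"

lemma split_word_permutation:
  assumes "n \<ge> 1"
  obtains \<sigma> where "\<sigma> permutes {1..n}" "split_word n K = map \<sigma> [1..<Suc n]"
proof -
  have set: "set (split_word n K) = {1..n}" and dist: "distinct (split_word n K)"
    using assms by (auto simp: split_word_def)
  then have len: "length (split_word n K) = n"
    using distinct_card by fastforce
  \<comment> \<open>Positions in a list count from 0, the variables from 1.\<close>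
  define \<sigma> where "\<sigma> j = (if j \<in> {1..n} then split_word n K ! (j - 1) else j)" for j
  have map: "split_word n K = map \<sigma> [1..<Suc n]"
    by (rule nth_equalityI) (auto simp: len \<sigma>_def simp del: upt_Suc)
  have "\<sigma> ` {1..n} = {1..n}"
  proof -
    have "\<sigma> ` set [1..<Suc n] = {1..n}"
      using set unfolding map by (simp del: upt_Suc)
    then show ?thesis by (simp add: atLeastLessThanSuc_atLeastAtMost del: upt_Suc)
  qed
  then have "bij_betw \<sigma> {1..n} {1..n}"
    by (simp add: bij_betw_def eq_card_imp_inj_on)
  then have "\<sigma> permutes {1..n}"
    by (rule bij_imp_permutes) (simp only: \<sigma>_def if_False)
  with map show ?thesis by (rule that[rotated])
qed

definition e11 :: "'f::field ^ 2 ^ 2" where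
  "e11 = (\<chi> i j. if i = 1 \<and> j = 1 then 1 else 0)"

definition test_point :: "nat set \<Rightarrow> nat \<Rightarrow> 'f::field ^ 2 ^ 2" where
  "test_point K j = (if j = 1 then e12 else if j \<in> K then e11 else e22)"

lemma test_point_upper: "test_point K j $ 2 $ 1 = 0"
  by (simp add: test_point_def e11_def e12_def e22_def)

lemma word_prod_UT2_delta:
  "xs \<noteq> [] \<Longrightarrow> word_prod UT2_delta xs = foldr (**) xs (mat 1)"
  by (induction xs rule: induct_list012) (simp_all add: UT2_delta_def)

lemma foldr_mult_mat: "foldr (**) xs (y :: 'f::field ^ 2 ^ 2) = foldr (**) xs (mat 1) ** y"
  by (induction xs) (simp_all add: matrix_mul_assoc[symmetric])

text \<open>
  The factors are \<open>e\<^sub>1\<^sub>1\<close> and \<open>e\<^sub>2\<^sub>2\<close>, hence the product of a mixed word is zero.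
\<close>
lemma foldr_test_point:
  assumes "1 \<notin> set xs"
  shows "foldr (**) (map (test_point K) xs) (mat 1 :: 'f::field ^ 2 ^ 2) =
    (\<chi> i j. if i = j \<and> (if i = 1 then set xs \<subseteq> K else set xs \<inter> K = {}) then 1 else 0)"
  using assms
  by (induction xs)
    (auto simp: vec_eq_iff forall_2 mat_def matrix_matrix_mult_def sum_2 test_point_def e11_def e22_def)

text \<open>
  The word survives at the test point of \<open>J\<close> only if all factors in front of \<open>e\<^sub>1\<^sub>2\<close> are \<open>e\<^sub>1\<^sub>1\<close>,
  that is \<open>K \<subseteq> J\<close>, and all factors behind it are \<open>e\<^sub>2\<^sub>2\<close>, that is \<open>J \<subseteq> K\<close>.
\<close>
lemma word_value_split_word:
  fixes u :: "('f::field_char_0, 'f ^ 2 ^ 2 \<Rightarrow> 'f ^ 2 ^ 2) env"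
  assumes u: "env_const u = 1" "env_lin u = 0" and "J \<subseteq> {2..n}" "K \<subseteq> {2..n}"
  shows "word_value t (test_point J) (map (\<lambda>i. (i, u)) (split_word n K)) $ 1 $ 2 =
    (if J = K then 1 else 0)"
proof -
  let ?p = "\<lambda>xs. foldr (**) (map (test_point J) xs) (mat 1 :: 'f ^ 2 ^ 2)"
  let ?xs = "filter (\<lambda>j. j \<in> K) [2..<Suc n]" and ?ys = "filter (\<lambda>j. j \<notin> K) [2..<Suc n]"
  have "letter_value t a (i, u) = a i" for a :: "nat \<Rightarrow> 'f ^ 2 ^ 2" and i
    by (simp add: letter_value_def u mat_scale_one mat_scale_zero)
  then have "word_value t (test_point J) (map (\<lambda>i. (i, u)) (split_word n K)) =
      word_prod UT2_delta (map (test_point J) (split_word n K))"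
    by (simp add: word_value_def o_def)
  also have "\<dots> = foldr (**) (map (test_point J) ?xs) (test_point J 1 ** ?p ?ys)"
    by (simp add: word_prod_UT2_delta split_word_def del: upt_Suc)
  also have "\<dots> = ?p ?xs ** (test_point J 1 ** ?p ?ys)"
    by (rule foldr_mult_mat)
  also have "\<dots> $ 1 $ 2 = (if set ?xs \<subseteq> J \<and> set ?ys \<inter> J = {} then 1 else 0)"
  proof -
    have "1 \<notin> set ?xs" "1 \<notin> set ?ys" by simp_all
    note diagonal = this[THEN foldr_test_point]
    show ?thesis
      by (simp add: diagonal matrix_matrix_mult_def sum_2 test_point_def e12_def del: set_filter upt_Suc)
  qed
  also have "set ?xs \<subseteq> J \<and> set ?ys \<inter> J = {} \<longleftrightarrow> J = K"
    using assms(3,4) by (auto simp: subset_iff disjoint_iff less_Suc_eq_le simp del: upt_Suc)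
  finally show ?thesis .
qed

lemma codim_scaled_UT2_ge:
  fixes B :: "('f::field_char_0, 'f ^ 2 ^ 2 \<Rightarrow> 'f ^ 2 ^ 2) env set"
  assumes emb: "inj emb" and B: "B \<subseteq> carrier (univ_env F_delta)"
    and one: "\<one>\<^bsub>univ_env (F_delta :: ('f, _) module)\<^esub> \<in> B" and n: "n \<ge> 1"
  shows "enat (2 ^ (n - 1)) \<le> codim B (scaled_UT2 emb t) n"
proof -
  let ?u = "\<one>\<^bsub>univ_env (F_delta :: ('f, 'f ^ 2 ^ 2 \<Rightarrow> 'f ^ 2 ^ 2) module)\<^esub>"
  let ?m = "\<lambda>K. Poly_Mapping.single (map (\<lambda>i. (i, ?u)) (split_word n K)) (1 :: 'f)"
  have "enat (card (Pow {2..n})) \<le> codim B (scaled_UT2 emb t) n"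
    unfolding codim_def codim_of_def
  proof (rule quotient_dim_ge[where m = ?m and g = "\<lambda>J w. word_value t (test_point J) w $ 1 $ 2"])
    fix K
    obtain \<sigma> where \<sigma>: "\<sigma> permutes {1..n}" "split_word n K = map \<sigma> [1..<Suc n]"
      using n by (rule split_word_permutation)
    then have "?m K = Poly_Mapping.single (map (\<lambda>i. (\<sigma> i, ?u)) [1..<Suc n]) 1"
      by (simp add: o_def del: upt_Suc)
    then show "?m K \<in> multilinear_polys B n"
      unfolding multilinear_polys_def using \<sigma>(1) one
      by (intro fa.span_base CollectI exI[of _ \<sigma>] exI[of _ "\<lambda>_. ?u"]) auto
  next
    fix J K
    assume "J \<in> Pow {2..n}" "K \<in> Pow {2..n}"
    then show "lin_ext (\<lambda>w. word_value t (test_point J) w $ 1 $ 2) (?m K) = (if J = K then 1 else 0)"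
      using env_parts_one[where 'f = 'f] by (simp add: word_value_split_word)
  next
    fix J f
    assume "f \<in> multilinear_polys B n \<inter> Id_L B (scaled_UT2 emb t)"
    then show "lin_ext (\<lambda>w. word_value t (test_point J) w $ 1 $ 2) f = 0"
      by (auto simp: Id_L_scaled_UT2[OF emb B] test_point_upper)
  qed simp
  then show ?thesis by (simp add: card_Pow)
qed

lemma not_polynomially_bounded_if_exponential:
  assumes "\<And>n. n \<ge> 1 \<Longrightarrow> enat (2 ^ (n - 1)) \<le> c n"
  shows "\<not> polynomially_bounded c"
proof
  assume "polynomially_bounded c"
  then obtain C k :: nat where Ck: "\<And>n. n \<ge> 1 \<Longrightarrow> c n \<le> enat (C * n ^ k)"
    by (auto simp: polynomially_bounded_def)
  have "eventually (\<lambda>n. real C * real n ^ k < 2 ^ n / 2) at_top"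
    by real_asymp
  then have "eventually (\<lambda>n. real C * real n ^ k < 2 ^ n / 2 \<and> n \<ge> 1) at_top"
    using eventually_ge_at_top[of 1] by (rule eventually_conj)
  then obtain n where n: "real C * real n ^ k < 2 ^ n / 2" "n \<ge> 1"
    by (auto simp: eventually_at_top_linorder)
  have "enat (2 ^ (n - 1)) \<le> enat (C * n ^ k)"
    using assms[OF n(2)] Ck[OF n(2)] by (rule order_trans)
  then have "2 ^ (n - 1) \<le> C * n ^ k" by simp
  then have "real (2 ^ (n - 1)) \<le> real (C * n ^ k)" by (rule of_nat_mono)
  with n show False by (cases n) simp_all
qed

section \<open>The variety of the triangular matrices with trivial action\<close>

text \<open>
  Any injection would do; this one stores the four entries of a matrix as the coefficients of four
  distinct words.
\<close>
definition dpoly_emb :: "'f::field_char_0 ^ 2 ^ 2 \<Rightarrow> ('f, 'f ^ 2 ^ 2 \<Rightarrow> 'f ^ 2 ^ 2) dpoly set" where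
  "dpoly_emb a = {Poly_Mapping.single [] (a $ 1 $ 1) + Poly_Mapping.single [(0, {})] (a $ 1 $ 2)
     + Poly_Mapping.single [(1, {})] (a $ 2 $ 1) + Poly_Mapping.single [(2, {})] (a $ 2 $ 2)}"

lemma inj_dpoly_emb: "inj dpoly_emb"
proof (rule injI)
  fix a b :: "'f::field_char_0 ^ 2 ^ 2"
  let ?p = "\<lambda>a :: 'f ^ 2 ^ 2. Poly_Mapping.single [] (a $ 1 $ 1) + Poly_Mapping.single [(0, {})] (a $ 1 $ 2)
     + Poly_Mapping.single [(1, {})] (a $ 2 $ 1) + Poly_Mapping.single [(2, {})] (a $ 2 $ 2)
     :: ('f, 'f ^ 2 ^ 2 \<Rightarrow> 'f ^ 2 ^ 2) dpoly"
  assume "dpoly_emb a = dpoly_emb b"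
  then have "Poly_Mapping.lookup (?p a) w = Poly_Mapping.lookup (?p b) w" for w
    by (simp add: dpoly_emb_def)
  from this[of "[]"] this[of "[(0, {})]"] this[of "[(1, {})]"] this[of "[(2, {})]"]
  show "a = b"
    by (simp add: lookup_add lookup_single when_def vec_eq_iff forall_2)
qed

text \<open>
  The separating identity is \<open>x\<^sup>h - c x\<close>, where \<open>h\<close> is a basis element with nonzero linear coefficient
  and \<open>c\<close> is its constant coefficient; its value is \<open>t\<close> times a nonzero multiple of \<open>\<delta> x\<close>.
\<close>
lemma Id_L_separates_scaled_UT2:
  fixes B :: "('f::field_char_0, 'f ^ 2 ^ 2 \<Rightarrow> 'f ^ 2 ^ 2) env set"
  assumes emb: "inj emb" and basis: "is_basis (univ_env F_delta) B"
    and one: "\<one>\<^bsub>univ_env (F_delta :: ('f, _) module)\<^esub> \<in> B"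
  shows "\<not> Id_L B (scaled_UT2 emb 0) \<subseteq> Id_L B (scaled_UT2 emb 1)"
proof -
  let ?u = "\<one>\<^bsub>univ_env (F_delta :: ('f, 'f ^ 2 ^ 2 \<Rightarrow> 'f ^ 2 ^ 2) module)\<^esub>"
  have B: "B \<subseteq> carrier (univ_env F_delta)" using basis by (simp add: is_basis_def)
  obtain h where h: "h \<in> B" "env_lin h \<noteq> 0" using basis by (rule basis_env_lin)
  let ?f = "Poly_Mapping.single [(0, h)] 1 - Poly_Mapping.single [(0, ?u)] (env_const h)
    :: ('f, 'f ^ 2 ^ 2 \<Rightarrow> 'f ^ 2 ^ 2) dpoly"
  have "Poly_Mapping.keys ?f \<subseteq> {[(0, h)], [(0, ?u)]}"
    using keys_diff[of "Poly_Mapping.single [(0, h)] (1 :: 'f)" "Poly_Mapping.single [(0, ?u)] (env_const h)"]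
    by (auto split: if_splits)
  then have f: "?f \<in> diff_polys B"
    using h(1) one by (auto simp: diff_polys_def)
  have val: "lin_ext (\<lambda>w. word_value t a w $ i $ k) ?f = t * env_lin h * delta (a 0) $ i $ k" for t a i k
    by (simp add: letter_value_def mat_scale_def env_parts_one)
  have "?f \<in> Id_L B (scaled_UT2 emb 0)"
    using f unfolding Id_L_scaled_UT2[OF emb B] val by simp
  moreover have "?f \<notin> Id_L B (scaled_UT2 emb 1)"
  proof
    assume "?f \<in> Id_L B (scaled_UT2 emb 1)"
    moreover have "(e22 :: 'f ^ 2 ^ 2) $ 2 $ 1 = 0" by (simp add: e22_def)
    ultimately have "lin_ext (\<lambda>w. word_value 1 (\<lambda>_. e22) w $ 1 $ 2) ?f = 0"
      unfolding Id_L_scaled_UT2[OF emb B] by (elim conjE allE[of _ "\<lambda>_. e22"]) (simp del: lin_ext_diff)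
    then have "env_lin h * delta (e22 :: 'f ^ 2 ^ 2) $ 1 $ 2 = 0"
      unfolding val by simp
    with h(2) show False by (simp add: delta_nth) (simp add: e22_def)
  qed
  ultimately show ?thesis by blast
qed

theorem theorem22:
  fixes B :: "('f::field_char_0, 'f ^ 2 ^ 2 \<Rightarrow> 'f ^ 2 ^ 2) env set"
  assumes "is_basis (univ_env F_delta) B"
    and "\<one>\<^bsub>univ_env (F_delta :: ('f, 'f ^ 2 ^ 2 \<Rightarrow> 'f ^ 2 ^ 2) module)\<^esub> \<in> B"
  shows "\<not> almost_polynomial_growth F_delta B (L_var F_delta B UT2_delta)"
proof
  let ?A = "\<lambda>t :: 'f. scaled_UT2 dpoly_emb t :: ('f, 'f ^ 2 ^ 2 \<Rightarrow> 'f ^ 2 ^ 2) univ_alg"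
  let ?V = "L_var F_delta B UT2_delta" and ?W = "L_var F_delta B (?A 0)"
  assume apg: "almost_polynomial_growth F_delta B ?V"
  have B: "B \<subseteq> carrier (univ_env F_delta)" using assms(1) by (simp add: is_basis_def)
  have alg: "L_algebra F_delta (?A t)" for t
    by (rule L_algebra_scaled_UT2[OF inj_dpoly_emb])
  have "?W \<subseteq> ?V"
    using Id_L_UT2_delta_subset[OF inj_dpoly_emb B] by (auto simp: L_var_def)
  moreover have "?A 1 \<in> ?V"
    using alg by (simp add: L_var_def Id_L_scaled_UT2_1[OF inj_dpoly_emb B])
  moreover have "?A 1 \<notin> ?W"
    using Id_L_separates_scaled_UT2[OF inj_dpoly_emb assms] by (simp add: L_var_def)
  ultimately have "?W \<subset> ?V" by blast
  moreover have "is_L_variety F_delta B ?W"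
    using alg by (auto simp: is_L_variety_def)
  ultimately have "polynomially_bounded (codim_class B ?W)"
    using apg by (simp add: almost_polynomial_growth_def polynomial_growth_def)
  moreover have "codim_class B ?W = codim B (?A 0)"
    by (rule ext) (rule fun_cong[OF codim_class_L_var[OF alg]])
  moreover have "\<not> polynomially_bounded (codim B (?A 0))"
    by (rule not_polynomially_bounded_if_exponential)
      (rule codim_scaled_UT2_ge[OF inj_dpoly_emb B assms(2)])
  ultimately show False by simp
qed

end
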